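(* Let $\alpha,\beta\in[0,1]$. For $n\ge2$, the complete graph $K_n$ on $n$ vertices satisfies \[ \mathrm{Z}_{\alpha,\beta}(K_n)=\begin{cases} n-1 & \text{if } \beta\le(n-1)\alpha,\\ n & \text{if } (n-1)\alpha<\beta.\end{cases} \]
   Context: All graphs are finite and simple. Let $\alpha,\beta\in[0,1]$ be two constants, called the transmission proportion and the transmission threshold respectively, let $G$ be a graph and $B\subseteq V(G)$ a set of initially filled vertices. The transmission forcing process started from $B$ is defined as follows. Put $B_0=B$, $w_0(v)=1$ for $v\in B$ and $w_0(v)=0$ for $v\in V(G)\setminus B$. For $t\ge 1$, given the set $B_{t-1}$ of vertices filled at time $t-1$ and the weights $w_{t-1}$: for each unfilled vertex $u\in V(G)\setminus B_{t-1}$ let $\mathcal V_{t,u}$ be the set of all $v\in B_{t-1}$ such that $u$ is the only neighbor of $v$ in $V(G)\setminus B_{t-1}$ and $v\notin \mathcal V_{s,u'}$ for every $s<t$ and every $u'$ (each vertex transmits weight at most once); when $v\in\mathcal V_{t,u}$ we say $v$ forces $u$, written $v\to u$. Set $w_t(u)=w_{t-1}(u)+\sum_{v\in\mathcal V_{t,u}}\alpha\, w_{t-1}(v)$ for $u\in V(G)\setminus B_{t-1}$ and $w_t(u)=w_{t-1}(u)$ for $u\in B_{t-1}$. Then $B_t=B_{t-1}\cup\{u\in V(G)\setminus B_{t-1} : w_t(u)\ge\beta\}$. The set $B$ is an $(\alpha,\beta)$-transmission zero forcing set of $G$ if $B_t=V(G)$ for some $t\ge 0$, and the $(\alpha,\beta)$-transmission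 zero forcing number $\mathrm{Z}_{\alpha,\beta}(G)$ is the minimum cardinality of such a set.
   Formalization: For β=0 the process as defined fills every vertex from the empty set, so the number is 0; the formula is proved for β≠0, and for all β in [0,1] for the variant in which a vertex must be forced in order to become filled. *)

theory Defs
  imports Complex_Main "Graph_Theory.Graph_Theory"
begin

text \<open>
  Graphs are those of the locale \<^locale>\<open>graph\<close> (finite symmetric digraphs without loops and
  without multiple arcs), so \<open>u \<rightarrow>\<^bsub>G\<^esub> v\<close> says that \<open>u\<close> and \<open>v\<close> are adjacent.

  A state of the transmission forcing process is a triple \<open>(F, w, D)\<close>: the set \<open>F\<close> of filled
  vertices, the weights \<open>w\<close>, and the set \<open>D\<close> of the vertices that have already transmitted, that
  is, the union of all \<open>\<V>\<^bsub>s,u'\<^esub>\<close> for the earlier steps \<open>s\<close>.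
\<close>

type_synonym 'a transmission_state = "'a set \<times> ('a \<Rightarrow> real) \<times> 'a set"

definition forcers :: "('a, 'b) pre_digraph \<Rightarrow> 'a set \<Rightarrow> 'a set \<Rightarrow> 'a \<Rightarrow> 'a set" where
  "forcers G F D u = {v \<in> F. {x \<in> verts G - F. v \<rightarrow>\<^bsub>G\<^esub> x} = {u} \<and> v \<notin> D}"

definition updated_weight ::
    "real \<Rightarrow> ('a, 'b) pre_digraph \<Rightarrow> 'a transmission_state \<Rightarrow> 'a \<Rightarrow> real" where
  "updated_weight \<alpha> G = (\<lambda>(F, w, D) u.
     if u \<in> verts G - F then w u + (\<Sum>v\<in>forcers G F D u. \<alpha> * w v) else w u)"

definition transmission_step ::
    "real \<Rightarrow> real \<Rightarrow> ('a, 'b) pre_digraph \<Rightarrow> 'a transmission_state \<Rightarrow> 'a transmission_state" where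
  "transmission_step \<alpha> \<beta> G = (\<lambda>(F, w, D).
     (F \<union> {u \<in> verts G - F. updated_weight \<alpha> G (F, w, D) u \<ge> \<beta>},
      updated_weight \<alpha> G (F, w, D),
      D \<union> (\<Union>u\<in>verts G - F. forcers G F D u)))"

definition initial_state :: "'a set \<Rightarrow> 'a transmission_state" where
  "initial_state B = (B, (\<lambda>v. if v \<in> B then 1 else 0), {})"

definition transmission_state ::
    "real \<Rightarrow> real \<Rightarrow> ('a, 'b) pre_digraph \<Rightarrow> 'a set \<Rightarrow> nat \<Rightarrow> 'a transmission_state" where
  "transmission_state \<alpha> \<beta> G B t = (transmission_step \<alpha> \<beta> G ^^ t) (initial_state B)"

definition transmission_zero_forcing_set ::
    "real \<Rightarrow> real \<Rightarrow> ('a, 'b) pre_digraph \<Rightarrow> 'a set \<Rightarrow> bool" where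
  "transmission_zero_forcing_set \<alpha> \<beta> G B \<longleftrightarrow>
     B \<subseteq> verts G \<and> (\<exists>t. fst (transmission_state \<alpha> \<beta> G B t) = verts G)"

definition transmission_zero_forcing_number ::
    "real \<Rightarrow> real \<Rightarrow> ('a, 'b) pre_digraph \<Rightarrow> nat" (\<open>Z\<^bsub>_,_\<^esub>\<close>) where
  "Z\<^bsub>\<alpha>,\<beta>\<^esub> G = Min (card ` {B. transmission_zero_forcing_set \<alpha> \<beta> G B})"

text \<open>
  For \<open>\<beta> = 0\<close> the condition \<open>w\<^sub>t(u) \<ge> \<beta>\<close> also holds for vertices that nobody forces, so that the
  empty set fills every graph in one step (lemma \<open>transmission_zero_forcing_number_0\<close> below).
  The following variant additionally requires that a vertex be forced in order to become filled.
  For \<open>\<beta> > 0\<close> this changes nothing (lemma \<open>strict_transmission_zero_forcing_number_eq\<close>), because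
  the weight of an unfilled vertex is then below \<open>\<beta>\<close> until somebody forces it.
\<close>

definition strict_transmission_step ::
    "real \<Rightarrow> real \<Rightarrow> ('a, 'b) pre_digraph \<Rightarrow> 'a transmission_state \<Rightarrow> 'a transmission_state" where
  "strict_transmission_step \<alpha> \<beta> G = (\<lambda>(F, w, D).
     (F \<union> {u \<in> verts G - F. forcers G F D u \<noteq> {} \<and> updated_weight \<alpha> G (F, w, D) u \<ge> \<beta>},
      updated_weight \<alpha> G (F, w, D),
      D \<union> (\<Union>u\<in>verts G - F. forcers G F D u)))"

definition strict_transmission_state ::
    "real \<Rightarrow> real \<Rightarrow> ('a, 'b) pre_digraph \<Rightarrow> 'a set \<Rightarrow> nat \<Rightarrow> 'a transmission_state" where
  "strict_transmission_state \<alpha> \<beta> G B t = (strict_transmission_step \<alpha> \<beta> G ^^ t) (initial_state B)"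

definition strict_transmission_zero_forcing_set ::
    "real \<Rightarrow> real \<Rightarrow> ('a, 'b) pre_digraph \<Rightarrow> 'a set \<Rightarrow> bool" where
  "strict_transmission_zero_forcing_set \<alpha> \<beta> G B \<longleftrightarrow>
     B \<subseteq> verts G \<and> (\<exists>t. fst (strict_transmission_state \<alpha> \<beta> G B t) = verts G)"

definition strict_transmission_zero_forcing_number ::
    "real \<Rightarrow> real \<Rightarrow> ('a, 'b) pre_digraph \<Rightarrow> nat" (\<open>Z\<^sup>s\<^bsub>_,_\<^esub>\<close>) where
  "Z\<^sup>s\<^bsub>\<alpha>,\<beta>\<^esub> G = Min (card ` {B. strict_transmission_zero_forcing_set \<alpha> \<beta> G B})"

lemma strict_transmission_step_eq:
  assumes "\<And>u. u \<in> verts G - fst S \<Longrightarrow> fst (snd S) u < \<beta>"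
  shows "strict_transmission_step \<alpha> \<beta> G S = transmission_step \<alpha> \<beta> G S"
proof -
  obtain F w D where S: "S = (F, w, D)" by (cases S)
  have "forcers G F D u \<noteq> {}"
    if "u \<in> verts G - F" "updated_weight \<alpha> G (F, w, D) u \<ge> \<beta>" for u
    using assms[of u] that by (auto simp: S updated_weight_def)
  then have "{u \<in> verts G - F. forcers G F D u \<noteq> {} \<and> updated_weight \<alpha> G (F, w, D) u \<ge> \<beta>}
      = {u \<in> verts G - F. updated_weight \<alpha> G (F, w, D) u \<ge> \<beta>}" by blast
  then show ?thesis by (simp add: S strict_transmission_step_def transmission_step_def)
qed

lemma transmission_state_weight_less:
  assumes "0 < \<beta>" "u \<in> verts G - fst (transmission_state \<alpha> \<beta> G B t)"
  shows "fst (snd (transmission_state \<alpha> \<beta> G B t)) u < \<beta>"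
  using assms(2)
proof (cases t)
  case 0
  then show ?thesis using assms by (auto simp: transmission_state_def initial_state_def)
next
  case (Suc s)
  obtain F w D where "(transmission_step \<alpha> \<beta> G ^^ s) (initial_state B) = (F, w, D)"
    by (metis surj_pair)
  then show ?thesis using assms(2)
    by (auto simp: Suc transmission_state_def transmission_step_def)
qed

lemma strict_transmission_state_eq:
  assumes "0 < \<beta>"
  shows "strict_transmission_state \<alpha> \<beta> G B t = transmission_state \<alpha> \<beta> G B t"
proof (induction t)
  case 0
  show ?case by (simp add: strict_transmission_state_def transmission_state_def)
next
  case (Suc t)
  have "strict_transmission_state \<alpha> \<beta> G B (Suc t)
      = strict_transmission_step \<alpha> \<beta> G (transmission_state \<alpha> \<beta> G B t)"
    using Suc by (simp add: strict_transmission_state_def)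
  also have "\<dots> = transmission_step \<alpha> \<beta> G (transmission_state \<alpha> \<beta> G B t)"
    by (rule strict_transmission_step_eq) (rule transmission_state_weight_less[OF assms])
  finally show ?case by (simp add: transmission_state_def)
qed

lemma strict_transmission_zero_forcing_number_eq:
  assumes "0 < \<beta>"
  shows "Z\<^sup>s\<^bsub>\<alpha>,\<beta>\<^esub> G = Z\<^bsub>\<alpha>,\<beta>\<^esub> G"
  by (simp add: strict_transmission_zero_forcing_number_def transmission_zero_forcing_number_def
      strict_transmission_zero_forcing_set_def transmission_zero_forcing_set_def
      strict_transmission_state_eq[OF assms])

lemma transmission_zero_forcing_number_0:
  assumes "finite (verts G)"
  shows "Z\<^bsub>\<alpha>,0\<^esub> G = 0"
proof -
  let ?A = "card ` {B. transmission_zero_forcing_set \<alpha> 0 G B}"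
  have "fst (transmission_state \<alpha> 0 G {} 1) = verts G"
    by (auto simp: transmission_state_def initial_state_def transmission_step_def
        updated_weight_def forcers_def)
  then have "transmission_zero_forcing_set \<alpha> 0 G {}"
    unfolding transmission_zero_forcing_set_def by blast
  then have "0 \<in> ?A" by force
  moreover have "{B. transmission_zero_forcing_set \<alpha> 0 G B} \<subseteq> Pow (verts G)"
    by (auto simp: transmission_zero_forcing_set_def)
  then have "finite ?A" using assms by (meson finite_Pow_iff finite_imageI finite_subset)
  ultimately show ?thesis
    unfolding transmission_zero_forcing_number_def by (metis Min_le le_zero_eq)
qed

end

theory Submission
  imports Defs
begin

text \<open>In a complete graph every filled vertex is adjacent to all unfilled ones, so it can
  force only when exactly one vertex is unfilled (\<open>complete_digraph_forcers\<close>). Under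
  the strict rule a set missing two or more vertices therefore never grows
  (\<open>complete_digraph_strict_zero_forcing_set_card\<close>). If a single vertex u is missing,
  the other n - 1 all transmit \<alpha> to it in the first step and can never transmit again, so u
  gets filled exactly when \<beta> \<le> (n - 1)\<alpha>
  (\<open>complete_digraph_strict_zero_forcing_set_iff\<close>). If this inequality fails, only the
  whole vertex set works. For \<beta> > 0 the plain and the strict process coincide, which carries
  the value over.\<close>

lemma strict_transmission_step_no_forcers:
  assumes "\<And>u. u \<in> verts G - F \<Longrightarrow> forcers G F D u = {}"
  shows "strict_transmission_step \<alpha> \<beta> G (F, w, D) = (F, w, D)"
  using assms by (auto simp: strict_transmission_step_def updated_weight_def fun_eq_iff)

text \<open>Stagnation: under the strict rule this holds whatever the weights are, whereas the plain
  rule would still fill an unforced vertex whose weight is at least \<beta>.\<close>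

lemma strict_transmission_steps_no_forcers:
  assumes "\<And>u. u \<in> verts G - F \<Longrightarrow> forcers G F D u = {}"
  shows "(strict_transmission_step \<alpha> \<beta> G ^^ t) (F, w, D) = (F, w, D)"
proof (induction t)
  case (Suc t)
  then show ?case using strict_transmission_step_no_forcers[OF assms] by simp
qed simp

lemma strict_transmission_zero_forcing_set_verts:
  "strict_transmission_zero_forcing_set \<alpha> \<beta> G (verts G)"
  unfolding strict_transmission_zero_forcing_set_def
  by (auto intro!: exI[of _ 0] simp: strict_transmission_state_def initial_state_def)

text \<open>The unfilled neighbors of any filled vertex are all the unfilled vertices, so the
  uniqueness condition in \<open>forcers\<close> does not depend on the forcing vertex.\<close>

lemma complete_digraph_forcers:
  assumes "K\<^bsub>n\<^esub> G" and "F \<subseteq> verts G" and "u \<in> verts G - F"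
  shows "forcers G F D u = (if verts G - F = {u} then F - D else {})"
proof -
  interpret graph G using assms(1) by (simp add: complete_digraph_def)
  have "arcs_ends G = {(a, b). a \<in> verts G \<and> b \<in> verts G \<and> a \<noteq> b}"
    using assms(1) by (auto simp: complete_digraph_def)
  then have "{x \<in> verts G - F. v \<rightarrow>\<^bsub>G\<^esub> x} = verts G - F" if "v \<in> F" for v
    using that assms(2) by auto
  then show ?thesis by (auto simp: forcers_def)
qed

lemma complete_digraph_strict_zero_forcing_set_card:
  assumes "K\<^bsub>n\<^esub> G" and "strict_transmission_zero_forcing_set \<alpha> \<beta> G B"
  shows "n \<le> card B + 1"
proof (rule ccontr)
  interpret graph G using assms(1) by (simp add: complete_digraph_def)
  assume "\<not> n \<le> card B + 1"
  moreover have B: "B \<subseteq> verts G"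
    using assms(2) by (simp add: strict_transmission_zero_forcing_set_def)
  moreover have "card (verts G) = n" using assms(1) by (simp add: complete_digraph_def)
  ultimately have "card (verts G - B) > 1"
    by (simp add: card_Diff_subset finite_subset)
  then have "verts G - B \<noteq> {u}" for u by force
  then have "forcers G B {} u = {}" if "u \<in> verts G - B" for u
    using complete_digraph_forcers[OF assms(1) B that] by simp
  then have "fst (strict_transmission_state \<alpha> \<beta> G B t) = B" for t
    using strict_transmission_steps_no_forcers[of G B "{}"]
    by (simp add: strict_transmission_state_def initial_state_def)
  moreover have "B \<noteq> verts G" using \<open>card (verts G - B) > 1\<close> by auto
  ultimately show False
    using assms(2) by (simp add: strict_transmission_zero_forcing_set_def)
qed

text \<open>The single unfilled vertex receives weight \<open>\<alpha>\<close> from each of the others, all in the first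
  step; afterwards nobody is left to transmit.\<close>

lemma complete_digraph_strict_zero_forcing_set_iff:
  assumes "K\<^bsub>n\<^esub> G" and "n \<ge> 2" and "u \<in> verts G"
  shows "strict_transmission_zero_forcing_set \<alpha> \<beta> G (verts G - {u}) \<longleftrightarrow> \<beta> \<le> real (n - 1) * \<alpha>"
proof -
  interpret graph G using assms(1) by (simp add: complete_digraph_def)
  define B where "B = verts G - {u}"
  have B: "B \<subseteq> verts G" "verts G - B = {u}" "u \<notin> B" "verts G = insert u B"
    using assms(3) by (auto simp: B_def)
  have "card (verts G) = n" using assms(1) by (simp add: complete_digraph_def)
  then have card: "card B = n - 1" using assms(3) by (simp add: B_def)
  then have "B \<noteq> {}" using assms(2) by auto
  \<comment> \<open>Used with \<open>D = {}\<close> in the first step, where all of \<open>B\<close>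
    forces u, and with \<open>D = B\<close> afterwards, where nobody does.\<close>
  have forcers: "forcers G B D u = B - D" for D
    using complete_digraph_forcers[OF assms(1) B(1), of u D] B by simp
  define w where "w = updated_weight \<alpha> G (initial_state B)"
  have "w u = real (n - 1) * \<alpha>"
    using B card by (simp add: w_def updated_weight_def initial_state_def forcers)
  \<comment> \<open>Since n \<ge> 2, \<open>B\<close> is nonempty and u really is forced, as the
    strict rule demands.\<close>
  then have step: "strict_transmission_step \<alpha> \<beta> G (initial_state B)
      = (if \<beta> \<le> real (n - 1) * \<alpha> then verts G else B, w, B)"
    using B \<open>B \<noteq> {}\<close>
    by (auto simp: strict_transmission_step_def initial_state_def w_def forcers)
  show ?thesis unfolding B_def[symmetric]
  proof
    assume "strict_transmission_zero_forcing_set \<alpha> \<beta> G B"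
    then obtain t where t: "fst (strict_transmission_state \<alpha> \<beta> G B t) = verts G"
      by (auto simp: strict_transmission_zero_forcing_set_def)
    show "\<beta> \<le> real (n - 1) * \<alpha>"
    proof (rule ccontr)
      assume "\<not> \<beta> \<le> real (n - 1) * \<alpha>"
      moreover have "(strict_transmission_step \<alpha> \<beta> G ^^ s) (B, w, B) = (B, w, B)" for s
        using B forcers by (intro strict_transmission_steps_no_forcers) auto
      \<comment> \<open>\<open>funpow_Suc_right\<close> splits off the first step, so that the
        remaining ones iterate from the fixed point \<open>(B, w, B)\<close>.\<close>
      ultimately have "fst (strict_transmission_state \<alpha> \<beta> G B t) = B"
        by (cases t) (simp_all add: strict_transmission_state_def initial_state_def[of B]
            step[unfolded initial_state_def] funpow_Suc_right
            del: funpow.simps(2))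
      then show False using t B by auto
    qed
  next
    assume "\<beta> \<le> real (n - 1) * \<alpha>"
    then have "fst (strict_transmission_state \<alpha> \<beta> G B 1) = verts G"
      by (simp add: strict_transmission_state_def step)
    then show "strict_transmission_zero_forcing_set \<alpha> \<beta> G B"
      using B by (auto simp: strict_transmission_zero_forcing_set_def)
  qed
qed

lemma strict_transmission_zero_forcing_number_complete:
  assumes "K\<^bsub>n\<^esub> G" and "n \<ge> 2"
  shows "Z\<^sup>s\<^bsub>\<alpha>,\<beta>\<^esub> G = (if \<beta> \<le> real (n - 1) * \<alpha> then n - 1 else n)"
proof -
  interpret graph G using assms(1) by (simp add: complete_digraph_def)
  have n: "card (verts G) = n" using assms(1) by (simp add: complete_digraph_def)
  let ?S = "{B. strict_transmission_zero_forcing_set \<alpha> \<beta> G B}"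
  have sub: "?S \<subseteq> Pow (verts G)" by (auto simp: strict_transmission_zero_forcing_set_def)
  then have fin: "finite (card ` ?S)" by (meson finite_Pow_iff finite_imageI finite_subset finite_verts)
  show ?thesis
  proof (cases "\<beta> \<le> real (n - 1) * \<alpha>")
    case True
    obtain u where u: "u \<in> verts G" using n assms(2) by fastforce
    then have "verts G - {u} \<in> ?S"
      using True complete_digraph_strict_zero_forcing_set_iff[OF assms u] by simp
    moreover have "card (verts G - {u}) = n - 1" using u n by simp
    ultimately have "n - 1 \<in> card ` ?S" by force
    moreover have "n - 1 \<le> k" if "k \<in> card ` ?S" for k
      using that complete_digraph_strict_zero_forcing_set_card[OF assms(1)] by fastforce
    ultimately show ?thesis
      using True fin by (simp add: strict_transmission_zero_forcing_number_def Min_eqI)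
  next
    case False
    have "B = verts G" if B: "B \<in> ?S" for B
    proof (rule ccontr)
      assume "B \<noteq> verts G"
      then obtain u where u: "u \<in> verts G" "u \<notin> B" using B sub by blast
      \<comment> \<open>The bound n \<le> card B + 1 leaves room for no second missing vertex, so
        \<open>B\<close> is exactly the set already excluded by the failing inequality.\<close>
      then have "B \<subseteq> verts G - {u}" using B sub by auto
      moreover have "card (verts G - {u}) \<le> card B"
        using B u n complete_digraph_strict_zero_forcing_set_card[OF assms(1)] by fastforce
      ultimately have "B = verts G - {u}" by (simp add: card_seteq)
      then show False
        using B False complete_digraph_strict_zero_forcing_set_iff[OF assms u(1)] by simp
    qed
    then have "?S = {verts G}" using strict_transmission_zero_forcing_set_verts by blast
    then show ?thesis
      using False n by (simp add: strict_transmission_zero_forcing_number_def)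
  qed
qed

text \<open>The case \<beta> = 0 is separated because the plain process then fills everything from
  the empty set: its number is 0, while the formula gives n - 1 \<ge> 1. The strict number obeys the
  formula there too.\<close>

theorem proposition4p1p1:
  fixes \<alpha> \<beta> :: real and n :: nat and G :: "('a, 'b) pre_digraph"
  assumes "\<alpha> \<in> {0..1}" and "\<beta> \<in> {0..1}" and "n \<ge> 2" and "K\<^bsub>n\<^esub> G"
  shows "(\<beta> \<noteq> 0 \<longrightarrow> Z\<^bsub>\<alpha>,\<beta>\<^esub> G = (if \<beta> \<le> real (n - 1) * \<alpha> then n - 1 else n)) \<and>
    Z\<^sup>s\<^bsub>\<alpha>,\<beta>\<^esub> G = (if \<beta> \<le> real (n - 1) * \<alpha> then n - 1 else n)"
proof
  show strict: "Z\<^sup>s\<^bsub>\<alpha>,\<beta>\<^esub> G = (if \<beta> \<le> real (n - 1) * \<alpha> then n - 1 else n)"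
    using assms(3,4) by (rule strict_transmission_zero_forcing_number_complete[rotated])
  show "\<beta> \<noteq> 0 \<longrightarrow> Z\<^bsub>\<alpha>,\<beta>\<^esub> G = (if \<beta> \<le> real (n - 1) * \<alpha> then n - 1 else n)"
  proof
    assume "\<beta> \<noteq> 0"
    then have "0 < \<beta>" using assms(2) by simp
    then show "Z\<^bsub>\<alpha>,\<beta>\<^esub> G = (if \<beta> \<le> real (n - 1) * \<alpha> then n - 1 else n)"
      using strict by (simp only: strict_transmission_zero_forcing_number_eq)
  qed
qed

end
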